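(* Let $-\infty<a<b<\infty$, let $1<p\le q<\infty$ with $\frac1p+\frac1q=1$, and let $\beta\in[0,1)$ and $\alpha\in\left(\beta+\frac1p,1\right]$. Let $u\in AC[a,b]$ with $\partial^{\alpha}_{a+}u\in L^p(a,b)$, where $\partial_{a+}^{\alpha}$ and $\partial_{a+}^{\beta}$ are the left Caputo fractional derivatives of orders $\alpha$ and $\beta$. Then $$\|\partial^{\beta}_{a+}u\|_{L^{\infty}(a,b)}\leq \frac{(b-a)^{\alpha-\beta-\frac{1}{p}}}{\left(\alpha q-\beta q-q+1\right)^{\frac{1}{q}}\Gamma(\alpha-\beta)} \left\|\partial^{\alpha}_{a+}u\right\|_{L^p(a,b)}.$$
   Context: $AC[a,b]$ is the space of (real- or complex-valued) absolutely continuous functions on $[a,b]$, and $\Gamma$ is the Euler gamma function. For $\alpha>0$ the left Riemann--Liouville integral is $I_{a+}^\alpha f(t)=\frac{1}{\Gamma(\alpha)}\int_a^t (t-s)^{\alpha-1}f(s)\,ds$, $t\in(a,b]$, and $I_{a+}^0 f=f$. For $0\le\alpha\le 1$ and $f\in AC[a,b]$ the left Caputo fractional derivative is $\partial_{a+}^\alpha f(t)=I_{a+}^{1-\alpha}f'(t)$ (defined for almost every $t$); in particular $\partial_{a+}^1 f=f'$ and, for order $0$, $\partial_{a+}^0f(t)=f(t)-f(a)$. *)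

theory Defs
  imports "HOL-Analysis.Analysis" "HOL-Probability.Essential_Supremum"
begin

text \<open>Degenerate intervals \<open>x k = y k\<close> are allowed in the finite families below; they contribute
  nothing to either sum.\<close>

definition absolutely_continuous_fun :: "real \<Rightarrow> real \<Rightarrow> (real \<Rightarrow> 'a::real_normed_vector) \<Rightarrow> bool" where
  "absolutely_continuous_fun a b f \<longleftrightarrow>
    (\<forall>\<epsilon>>0. \<exists>\<delta>>0. \<forall>(n::nat) x y.
      (\<forall>k<n. a \<le> x k \<and> x k \<le> y k \<and> y k \<le> b) \<and>
      disjoint_family_on (\<lambda>k. {x k<..<y k}) {..<n} \<and>
      (\<Sum>k<n. y k - x k) < \<delta> \<longrightarrow>
      (\<Sum>k<n. norm (f (y k) - f (x k))) < \<epsilon>)"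

text \<open>For \<open>\<alpha> > 0\<close> the value at a point where the integrand is not Lebesgue integrable is 0, by
  the convention of the Bochner integral. For integrable \<open>f\<close> such points form a null set.\<close>

definition rl_integral ::
    "real \<Rightarrow> real \<Rightarrow> (real \<Rightarrow> 'a::{banach,second_countable_topology}) \<Rightarrow> real \<Rightarrow> 'a" where
  "rl_integral a \<alpha> f t =
    (if \<alpha> = 0 then f t
     else (1 / Gamma \<alpha>) *\<^sub>R (LINT s:{a..t}|lebesgue. ((t - s) powr (\<alpha> - 1)) *\<^sub>R f s))"

text \<open>The derivative is two-sided for \<open>t\<close> in the open interval and depends only on the values
  of \<open>f\<close> on \<open>{a..b}\<close>. It is a fixed unspecified value where \<open>f\<close> is not differentiable, which for
  absolutely continuous \<open>f\<close> happens only on a null set.\<close>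

definition caputo_deriv ::
    "real \<Rightarrow> real \<Rightarrow> real \<Rightarrow> (real \<Rightarrow> 'a::{banach,second_countable_topology}) \<Rightarrow> real \<Rightarrow> 'a" where
  "caputo_deriv a b \<alpha> f =
    rl_integral a (1 - \<alpha>) (\<lambda>s. vector_derivative f (at s within {a..b}))"

definition Lp_space :: "real \<Rightarrow> 'b measure \<Rightarrow> ('b \<Rightarrow> 'a::real_normed_vector) set" where
  "Lp_space p M = {f \<in> borel_measurable M. integrable M (\<lambda>t. norm (f t) powr p)}"

definition Lp_norm :: "real \<Rightarrow> 'b measure \<Rightarrow> ('b \<Rightarrow> 'a::real_normed_vector) \<Rightarrow> real" where
  "Lp_norm p M f = (LINT t|M. norm (f t) powr p) powr (1 / p)"

text \<open>As with \<^const>\<open>esssup\<close>, a non-measurable function gets the value \<open>\<infinity>\<close>; hence a finite value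
  says that \<open>f\<close> belongs to the space of essentially bounded functions.\<close>

definition Linf_norm :: "'b measure \<Rightarrow> ('b \<Rightarrow> 'a::real_normed_vector) \<Rightarrow> ereal" where
  "Linf_norm M f =
    (if f \<in> borel_measurable M then esssup M (\<lambda>t. ereal (norm (f t))) else \<infinity>)"

end

theory Submission
  imports Defs
begin

text \<open>With \<open>\<gamma> = \<alpha> - \<beta>\<close>, Fubini's theorem and the Beta integral give the semigroup law
  \<open>I\<^sup>\<gamma> I\<^sup>1\<^sup>-\<^sup>\<alpha> u' = I\<^sup>1\<^sup>-\<^sup>\<beta> u'\<close>, so that \<open>\<partial>\<^sup>\<beta> u = I\<^sup>\<gamma> \<partial>\<^sup>\<alpha> u\<close>. Hoelder's inequality applied to the kernel
  \<open>(t - s) powr (\<gamma> - 1)\<close>, whose \<open>q\<close>-th power is integrable since \<open>\<gamma> > 1 / p\<close>, gives the bound.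
  The argument is carried out at each point \<open>t\<close> separately: where the integral defining
  \<open>\<partial>\<^sup>\<beta> u t\<close> converges absolutely, Fubini's theorem applies, and elsewhere its value is 0 by
  convention. Hence all that is needed of \<open>u'\<close> is measurability, which follows from
  continuity of \<open>u\<close>.\<close>

section \<open>Measurability of the derivative of a continuous function\<close>

lemma has_vector_derivative_at_iff_quotient:
  "(v has_vector_derivative L) (at x) \<longleftrightarrow> ((\<lambda>h. (v (x + h) - v x) /\<^sub>R h) \<longlongrightarrow> L) (at 0)"
proof -
  have "norm (v (x + h) - v x - h *\<^sub>R L) / norm h = norm ((v (x + h) - v x) /\<^sub>R h - L)" if "h \<noteq> 0" for h
  proof -
    have "(v (x + h) - v x) /\<^sub>R h - L = (v (x + h) - v x - h *\<^sub>R L) /\<^sub>R h"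
      using that by (simp add: scaleR_diff_right)
    then show ?thesis
      by (simp add: divide_inverse mult.commute)
  qed
  then have "(v has_vector_derivative L) (at x) \<longleftrightarrow>
      ((\<lambda>h. norm ((v (x + h) - v x) /\<^sub>R h - L)) \<longlongrightarrow> 0) (at 0)"
    unfolding has_vector_derivative_def has_derivative_at
    by (simp add: bounded_linear_scaleR_left cong: LIM_cong)
  then show ?thesis
    by (simp add: tendsto_norm_zero_iff LIM_zero_iff)
qed

text \<open>Completeness removes the unknown limit \<open>L\<close> and leaves only countable
  quantifiers over \<open>n\<close> and \<open>m\<close> outside the one over \<open>h\<close> and
  \<open>k\<close>. The bound by \<open>1 / Suc n\<close> is non-strict so that it defines closed
  sets and survives limits.\<close>

lemma tendsto_at_0_iff_Cauchy:
  fixes \<phi> :: "real \<Rightarrow> 'a::banach"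
  shows "(\<exists>L. (\<phi> \<longlongrightarrow> L) (at 0)) \<longleftrightarrow>
    (\<forall>n. \<exists>m. \<forall>h k. h \<noteq> 0 \<and> \<bar>h\<bar> < 1 / Suc m \<and> k \<noteq> 0 \<and> \<bar>k\<bar> < 1 / Suc m
        \<longrightarrow> norm (\<phi> h - \<phi> k) \<le> 1 / Suc n)" (is "?lim \<longleftrightarrow> ?cau")
proof
  assume ?lim
  then obtain L where L: "(\<phi> \<longlongrightarrow> L) (at 0)" ..
  show ?cau
  proof
    fix n
    have "1 / (2 * real (Suc n)) > 0"
      by simp
    with L obtain d where "d > 0"
      and d: "\<And>h. h \<noteq> 0 \<Longrightarrow> \<bar>h\<bar> < d \<Longrightarrow> norm (\<phi> h - L) < 1 / (2 * real (Suc n))"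
      unfolding LIM_eq by (metis diff_zero real_norm_def)
    from \<open>d > 0\<close> obtain m where m: "1 / Suc m < d"
      using nat_approx_posE by blast
    have "norm (\<phi> h - \<phi> k) \<le> 1 / Suc n" 
      if "h \<noteq> 0" "\<bar>h\<bar> < 1 / Suc m" "k \<noteq> 0" "\<bar>k\<bar> < 1 / Suc m" for h k
    proof -
      have "norm (\<phi> h - \<phi> k) \<le> norm (\<phi> h - L) + norm (\<phi> k - L)"
        by (metis norm_triangle_ineq4 diff_diff_eq2 diff_add_cancel)
      also have "\<dots> \<le> 1 / (2 * real (Suc n)) + 1 / (2 * real (Suc n))"
        using that m d[of h] d[of k] by linarith
      also have "\<dots> = 1 / Suc n"
        by (simp add: field_simps)
      finally show ?thesis .
    qed
    then show "\<exists>m. \<forall>h k. h \<noteq> 0 \<and> \<bar>h\<bar> < 1 / Suc m \<and> k \<noteq> 0 \<and> \<bar>k\<bar> < 1 / Suc m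
        \<longrightarrow> norm (\<phi> h - \<phi> k) \<le> 1 / Suc n"
      by blast
  qed
next
  assume cau: ?cau
  define X where "X = (\<lambda>n. \<phi> (1 / Suc n))"
  have small: "1 / real (Suc k) < 1 / real (Suc m)" if "k > m" for k m
    using that by (simp add: field_simps)
  have "Cauchy X"
  proof (rule metric_CauchyI)
    fix e :: real assume "e > 0"
    then obtain n where n: "1 / Suc n < e"
      using nat_approx_posE by blast
    from cau obtain m where m: "\<And>h k. h \<noteq> 0 \<Longrightarrow> \<bar>h\<bar> < 1 / Suc m \<Longrightarrow> k \<noteq> 0 \<Longrightarrow> \<bar>k\<bar> < 1 / Suc m
        \<Longrightarrow> norm (\<phi> h - \<phi> k) \<le> 1 / Suc n"
      by meson
    \<comment> \<open>The index starts at \<open>Suc m\<close> because \<open>1 / Suc i\<close> must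
      lie strictly below \<open>1 / Suc m\<close>.\<close>
    have "dist (X i) (X j) < e" if "i \<ge> Suc m" "j \<ge> Suc m" for i j
    proof -
      have "norm (X i - X j) \<le> 1 / Suc n"
        unfolding X_def by (rule m) (use that small[of m i] small[of m j] in auto)
      with n show ?thesis
        by (simp add: dist_norm)
    qed
    then show "\<exists>M. \<forall>i\<ge>M. \<forall>j\<ge>M. dist (X i) (X j) < e"
      by blast
  qed
  then obtain L where L: "X \<longlonglongrightarrow> L"
    using Cauchy_convergent convergent_def by blast
  have "(\<phi> \<longlongrightarrow> L) (at 0)"
    unfolding LIM_eq
  proof (intro allI impI)
    fix e :: real assume "e > 0"
    then obtain n where n: "1 / Suc n < e"
      using nat_approx_posE by blast
    from cau obtain m where m: "\<And>h k. h \<noteq> 0 \<Longrightarrow> \<bar>h\<bar> < 1 / Suc m \<Longrightarrow> k \<noteq> 0 \<Longrightarrow> \<bar>k\<bar> < 1 / Suc m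
        \<Longrightarrow> norm (\<phi> h - \<phi> k) \<le> 1 / Suc n"
      by meson
    have "norm (\<phi> h - L) < e" if "h \<noteq> 0" "\<bar>h\<bar> < 1 / Suc m" for h
    proof -
      \<comment> \<open>The sample \<open>X i\<close> is a value of \<open>\<phi>\<close> at an
        admissible point, so the Cauchy bound applies to it; letting \<open>i\<close> grow replaces
        it by \<open>L\<close>.\<close>
      have "(\<lambda>i. norm (\<phi> h - X i)) \<longlonglongrightarrow> norm (\<phi> h - L)"
        by (intro tendsto_intros L)
      moreover have "norm (\<phi> h - X i) \<le> 1 / Suc n" if "i \<ge> Suc m" for i
        unfolding X_def
        by (rule m) (use \<open>h \<noteq> 0\<close> \<open>\<bar>h\<bar> < 1 / Suc m\<close> that small[of m i] in auto)
      ultimately have "norm (\<phi> h - L) \<le> 1 / Suc n"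
        by (intro LIMSEQ_le_const2) auto
      with n show ?thesis by simp
    qed
    then show "\<exists>s>0. \<forall>h. h \<noteq> 0 \<and> norm (h - 0) < s \<longrightarrow> norm (\<phi> h - L) < e"
      by (intro exI[of _ "1 / Suc m"]) auto
  qed
  then show ?lim ..
qed

text \<open>On the set \<open>D\<close> of differentiability the derivative is a sequential limit of
  difference quotients, each continuous in \<open>x\<close>; off \<open>D\<close> it is constant. So
  everything rests on \<open>D\<close> being Borel.\<close>

lemma borel_measurable_vector_derivative:
  fixes v :: "real \<Rightarrow> 'a::{banach, second_countable_topology}"
  assumes v: "continuous_on UNIV v"
  shows "(\<lambda>x. vector_derivative v (at x)) \<in> borel_measurable borel"
proof -
  define Q where "Q = (\<lambda>x h. (v (x + h) - v x) /\<^sub>R h)"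
  define D where "D = {x. \<exists>L. (Q x \<longlongrightarrow> L) (at 0)}"
  define C where "C = (\<lambda>n m. {x. \<forall>h k. h \<noteq> 0 \<and> \<bar>h\<bar> < 1 / Suc m \<and> k \<noteq> 0 \<and> \<bar>k\<bar> < 1 / Suc m
        \<longrightarrow> norm (Q x h - Q x k) \<le> 1 / Suc n})"
  have hvd: "(v has_vector_derivative L) (at x) \<longleftrightarrow> (Q x \<longlongrightarrow> L) (at 0)" for x L
    unfolding Q_def by (rule has_vector_derivative_at_iff_quotient)
  have cont_Q: "continuous_on UNIV (\<lambda>x. Q x h)" for h
    unfolding Q_def by (intro continuous_intros continuous_on_compose2[OF v]) auto
  \<comment> \<open>Cauchy's criterion makes \<open>D\<close> a countable combination of closed sets.\<close>
  have "D = (\<Inter>n. \<Union>m. C n m)"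
    unfolding D_def C_def by (auto simp: tendsto_at_0_iff_Cauchy)
  \<comment> \<open>For fixed \<open>h\<close> and \<open>k\<close> the premise does not depend on
    \<open>x\<close> and the conclusion is a non-strict inequality between continuous functions of
    \<open>x\<close>; \<open>C n m\<close> is the intersection of these closed sets.\<close>
  moreover have "closed (C n m)" for n m
    unfolding C_def
    by (intro closed_Collect_all closed_Collect_imp closed_Collect_le open_Collect_const
        continuous_intros cont_Q)
  ultimately have D[measurable]: "D \<in> sets borel"
    by (simp add: borel_closed)
  \<comment> \<open>Where no derivative exists, the predicate under the choice operator is
    identically false, hence the same chosen value at every such \<open>x\<close>.\<close>
  have eq: "vector_derivative v (at x) =
      (if x \<in> D then lim (\<lambda>n. Q x (1 / Suc n)) else (SOME L. False))" for x
  proof (cases "x \<in> D")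
    case True
    then obtain L where L: "(Q x \<longlongrightarrow> L) (at 0)"
      by (auto simp: D_def)
    have "filterlim (\<lambda>n. 1 / real (Suc n)) (at 0) sequentially"
      unfolding filterlim_at using LIMSEQ_inverse_real_of_nat by (simp add: inverse_eq_divide)
    then have "(\<lambda>n. Q x (1 / Suc n)) \<longlonglongrightarrow> L"
      by (rule filterlim_compose[OF L])
    moreover have "vector_derivative v (at x) = L"
      using L by (intro vector_derivative_at) (simp add: hvd)
    ultimately show ?thesis
      using True by (simp add: limI)
  next
    case False
    then show ?thesis
      by (simp add: vector_derivative_def hvd D_def)
  qed
  have [measurable]: "(\<lambda>x. Q x h) \<in> borel_measurable borel" for h
    by (rule borel_measurable_continuous_onI[OF cont_Q])
  show ?thesis
    unfolding eq by measurable
qed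

lemma absolutely_continuous_fun_imp_continuous_on:
  assumes "absolutely_continuous_fun a b f"
  shows "continuous_on {a..b} f"
  unfolding continuous_on_iff
proof (intro ballI allI impI)
  fix x e :: real assume x: "x \<in> {a..b}" and "e > 0"
  with assms obtain d where "d > 0"
    and d: "\<And>(n::nat) X Y. (\<forall>k<n. a \<le> X k \<and> X k \<le> Y k \<and> Y k \<le> b) \<and>
      disjoint_family_on (\<lambda>k. {X k<..<Y k}) {..<n} \<and> (\<Sum>k<n. Y k - X k) < d \<Longrightarrow>
      (\<Sum>k<n. norm (f (Y k) - f (X k))) < e"
    unfolding absolutely_continuous_fun_def by meson
  \<comment> \<open>Families consisting of a single interval already give continuity.\<close>
  have "norm (f y - f z) < e \<and> norm (f z - f y) < e"
    if "a \<le> z" "z \<le> y" "y \<le> b" "y - z < d" for y z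
    using d[of 1 "\<lambda>_. z" "\<lambda>_. y"] that
    by (simp add: disjoint_family_on_def norm_minus_commute)
  then have "dist (f y) (f x) < e" if "y \<in> {a..b}" "dist y x < d" for y
    using that x by (cases "x \<le> y") (auto simp: dist_norm)
  with \<open>d > 0\<close> show "\<exists>d>0. \<forall>y\<in>{a..b}. dist y x < d \<longrightarrow> dist (f y) (f x) < e"
    by blast
qed

text \<open>Clamping the argument to \<open>{a..b}\<close> extends \<open>u\<close> to a continuous
  function on the line with the same derivative in the open interval. The indicator discards the
  endpoints, where the derivative within \<open>{a..b}\<close> is one-sided.\<close>

lemma borel_measurable_vector_derivative_within:
  fixes u :: "real \<Rightarrow> 'a::{banach, second_countable_topology}"
  assumes "a < b" and u: "continuous_on {a..b} u"
  shows "(\<lambda>s. indicator {a<..<b} s *\<^sub>R vector_derivative u (at s within {a..b}))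
    \<in> borel_measurable borel"
proof -
  define v where "v = (\<lambda>x. u (max a (min b x)))"
  have "continuous_on UNIV v"
    unfolding v_def using \<open>a < b\<close>
    by (intro continuous_on_compose2[OF u] continuous_intros) auto
  then have [measurable]: "(\<lambda>x. vector_derivative v (at x)) \<in> borel_measurable borel"
    by (rule borel_measurable_vector_derivative)
  have "vector_derivative u (at s within {a..b}) = vector_derivative v (at s)"
    if "s \<in> {a<..<b}" for s
  proof -
    have "eventually (\<lambda>x. x \<in> {a<..<b}) (nhds s)"
      using that by (intro eventually_nhds_in_open) auto
    then have "\<forall>\<^sub>F x in nhds s. x \<in> UNIV \<longrightarrow> u x = v x"
      by (rule eventually_mono) (auto simp: v_def)
    then have "vector_derivative u (at s within UNIV) = vector_derivative v (at s within UNIV)"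
      using that by (intro vector_derivative_cong_eq) (auto simp: v_def)
    with that show ?thesis
      by (simp add: at_within_Icc_at)
  qed
  then have "(\<lambda>s. indicator {a<..<b} s *\<^sub>R vector_derivative u (at s within {a..b})) =
      (\<lambda>s. indicator {a<..<b} s *\<^sub>R vector_derivative v (at s))"
    by (auto split: split_indicator)
  then show ?thesis
    by simp
qed

section \<open>The Riemann-Liouville kernel\<close>

text \<open>Extending the kernel by 0 to the negative half-line turns integrals over \<open>{a..t}\<close> into
  convolutions over the whole line.\<close>

definition rl_kernel :: "real \<Rightarrow> real \<Rightarrow> real" where
  "rl_kernel \<gamma> x = (if 0 < x then x powr (\<gamma> - 1) else 0)"

lemma rl_kernel_nonneg [simp]: "0 \<le> rl_kernel \<gamma> x"
  by (simp add: rl_kernel_def)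

lemma borel_measurable_rl_kernel [measurable]: "rl_kernel \<gamma> \<in> borel_measurable borel"
  unfolding rl_kernel_def by measurable

text \<open>The substitution \<open>s = r + T * x\<close> with \<open>T = t - r\<close> carries the
  interval from \<open>r\<close> to \<open>t\<close> to the unit interval and leaves the Beta
  integral. For \<open>t \<le> r\<close> the two kernels are never both nonzero.\<close>

lemma nn_integral_rl_kernel_convolution:
  assumes "\<gamma> > 0" "\<delta> > 0"
  shows "(\<integral>\<^sup>+s. ennreal (rl_kernel \<gamma> (t - s) * rl_kernel \<delta> (s - r)) \<partial>lborel)
    = ennreal (Beta \<gamma> \<delta> * rl_kernel (\<gamma> + \<delta>) (t - r))"
proof (cases "r < t")
  case False
  then have "rl_kernel \<gamma> (t - s) * rl_kernel \<delta> (s - r) = 0" for s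
    by (auto simp: rl_kernel_def)
  then have "(\<integral>\<^sup>+s. ennreal (rl_kernel \<gamma> (t - s) * rl_kernel \<delta> (s - r)) \<partial>lborel) = 0"
    by (simp only: ennreal_0 nn_integral_const mult_zero_left)
  with False show ?thesis
    by (simp add: rl_kernel_def)
next
  case True
  define T where "T = t - r"
  have "T > 0"
    using True by (simp add: T_def)
  \<comment> \<open>The endpoints of \<open>{0..1}\<close> agree too, since \<open>0 powr e\<close>
    is 0 for every \<open>e\<close>. The Jacobian \<open>T\<close> will raise the exponent to that
    of the kernel of order \<open>\<gamma> + \<delta>\<close>.\<close>
  have pt: "rl_kernel \<gamma> (t - (r + T * x)) * rl_kernel \<delta> (r + T * x - r) =
      T powr (\<gamma> + \<delta> - 2) * (x powr (\<delta> - 1) * (1 - x) powr (\<gamma> - 1) * indicator {0..1} x)" for x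
  proof -
    have "t - (r + T * x) = T * (1 - x)"
      by (simp add: T_def algebra_simps)
    moreover have "T powr (\<gamma> + \<delta> - 2) = T powr (\<gamma> - 1) * T powr (\<delta> - 1)"
      by (simp add: powr_add [symmetric])
    ultimately show ?thesis
      using \<open>T > 0\<close>
      by (auto simp: rl_kernel_def powr_mult indicator_def zero_less_mult_iff)
  qed
  have "(\<integral>\<^sup>+s. ennreal (rl_kernel \<gamma> (t - s) * rl_kernel \<delta> (s - r)) \<partial>lborel) =
      T * (\<integral>\<^sup>+x. ennreal (rl_kernel \<gamma> (t - (r + T * x)) * rl_kernel \<delta> (r + T * x - r)) \<partial>lborel)"
    using \<open>T > 0\<close> by (subst nn_integral_real_affine[where c = T and t = r]) auto
  also have "\<dots> = T * (\<integral>\<^sup>+x. T powr (\<gamma> + \<delta> - 2) *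
      (ennreal (x powr (\<delta> - 1) * (1 - x) powr (\<gamma> - 1)) * indicator {0..1} x) \<partial>lborel)"
    unfolding pt by (intro arg_cong2[where f = "(*)"] nn_integral_cong refl)
      (auto simp: ennreal_mult' indicator_def)
  also have "\<dots> = T * (T powr (\<gamma> + \<delta> - 2) * ennreal (Beta \<delta> \<gamma>))"
    using nn_integral_has_integral_lebesgue'[OF _ has_integral_Beta_real[of \<delta> \<gamma>]] assms
    by (subst nn_integral_cmult) auto
  also have "\<dots> = ennreal (T powr 1 * T powr (\<gamma> + \<delta> - 2) * Beta \<delta> \<gamma>)"
    using \<open>T > 0\<close> by (simp add: ennreal_mult' mult.assoc)
  also have "T powr 1 * T powr (\<gamma> + \<delta> - 2) * Beta \<delta> \<gamma> = Beta \<gamma> \<delta> * rl_kernel (\<gamma> + \<delta>) (t - r)"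
    using \<open>T > 0\<close> unfolding powr_add [symmetric]
    by (simp add: rl_kernel_def T_def Beta_commute)
  finally show ?thesis .
qed

text \<open>Integrating the norm over \<open>s\<close> first turns the two kernels into a multiple
  of the kernel of order \<open>\<gamma> + \<delta>\<close>. By Tonelli, \<open>int\<close> at the
  single point \<open>t\<close> therefore makes the double integrand integrable, and Fubini
  exchanges the order.\<close>

lemma rl_kernel_semigroup:
  fixes g :: "real \<Rightarrow> 'a::{banach, second_countable_topology}"
  assumes "\<gamma> > 0" "\<delta> > 0" and [measurable]: "g \<in> borel_measurable borel"
    and int: "integrable lborel (\<lambda>r. rl_kernel (\<gamma> + \<delta>) (t - r) *\<^sub>R g r)"
  shows "(\<integral>s. rl_kernel \<gamma> (t - s) *\<^sub>R (\<integral>r. rl_kernel \<delta> (s - r) *\<^sub>R g r \<partial>lborel) \<partial>lborel)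
    = Beta \<gamma> \<delta> *\<^sub>R (\<integral>r. rl_kernel (\<gamma> + \<delta>) (t - r) *\<^sub>R g r \<partial>lborel)"
proof -
  define f where "f = (\<lambda>r s. (rl_kernel \<gamma> (t - s) * rl_kernel \<delta> (s - r)) *\<^sub>R g r)"
  have B: "Beta \<gamma> \<delta> \<ge> 0"
    using assms by (auto simp: Beta_def intro!: divide_nonneg_nonneg mult_nonneg_nonneg)
  have conv: "has_bochner_integral lborel (\<lambda>s. rl_kernel \<gamma> (t - s) * rl_kernel \<delta> (s - r))
      (Beta \<gamma> \<delta> * rl_kernel (\<gamma> + \<delta>) (t - r))" for r
    using nn_integral_rl_kernel_convolution[OF assms(1,2)] B
    by (intro has_bochner_integral_nn_integral) auto
  have "integrable (lborel \<Otimes>\<^sub>M lborel) (case_prod f)"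
  proof (rule integrableI_bounded)
    show "case_prod f \<in> borel_measurable (lborel \<Otimes>\<^sub>M lborel)"
      unfolding f_def by measurable
    have "(\<integral>\<^sup>+z. ennreal (norm (case_prod f z)) \<partial>(lborel \<Otimes>\<^sub>M lborel)) =
        (\<integral>\<^sup>+r. \<integral>\<^sup>+s. ennreal (norm (f r s)) \<partial>lborel \<partial>lborel)"
      unfolding f_def by (subst lborel.nn_integral_fst [symmetric]) auto
    also have "\<dots> = (\<integral>\<^sup>+r. Beta \<gamma> \<delta> * ennreal (norm (rl_kernel (\<gamma> + \<delta>) (t - r) *\<^sub>R g r)) \<partial>lborel)"
    proof (rule nn_integral_cong)
      fix r
      have "(\<integral>\<^sup>+s. ennreal (norm (f r s)) \<partial>lborel) =
          (\<integral>\<^sup>+s. ennreal (rl_kernel \<gamma> (t - s) * rl_kernel \<delta> (s - r)) * ennreal (norm (g r)) \<partial>lborel)"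
        by (simp add: f_def ennreal_mult)
      also have "\<dots> = ennreal (Beta \<gamma> \<delta> * rl_kernel (\<gamma> + \<delta>) (t - r)) * ennreal (norm (g r))"
        by (subst nn_integral_multc) (auto simp: nn_integral_rl_kernel_convolution assms)
      also have "\<dots> = Beta \<gamma> \<delta> * ennreal (norm (rl_kernel (\<gamma> + \<delta>) (t - r) *\<^sub>R g r))"
        using B by (simp add: ennreal_mult mult.assoc)
      finally show "(\<integral>\<^sup>+s. ennreal (norm (f r s)) \<partial>lborel) = \<dots>" .
    qed
    also have "\<dots> = Beta \<gamma> \<delta> * (\<integral>\<^sup>+r. ennreal (norm (rl_kernel (\<gamma> + \<delta>) (t - r) *\<^sub>R g r)) \<partial>lborel)"
      by (rule nn_integral_cmult) auto
    also have "\<dots> < \<infinity>"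
      using int by (auto simp: integrable_iff_bounded ennreal_mult_less_top)
    finally show "(\<integral>\<^sup>+z. ennreal (norm (case_prod f z)) \<partial>(lborel \<Otimes>\<^sub>M lborel)) < \<infinity>" .
  qed
  then have "(\<integral>s. (\<integral>r. f r s \<partial>lborel) \<partial>lborel) = (\<integral>r. (\<integral>s. f r s \<partial>lborel) \<partial>lborel)"
    by (rule lborel_pair.Fubini_integral)
  moreover have "(\<integral>r. f r s \<partial>lborel) =
      rl_kernel \<gamma> (t - s) *\<^sub>R (\<integral>r. rl_kernel \<delta> (s - r) *\<^sub>R g r \<partial>lborel)" for s
    unfolding f_def by (simp flip: scaleR_scaleR)
  moreover have "(\<integral>s. f r s \<partial>lborel) = Beta \<gamma> \<delta> *\<^sub>R (rl_kernel (\<gamma> + \<delta>) (t - r) *\<^sub>R g r)" for r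
  proof -
    have "has_bochner_integral lborel (f r) ((Beta \<gamma> \<delta> * rl_kernel (\<gamma> + \<delta>) (t - r)) *\<^sub>R g r)"
      unfolding f_def by (intro has_bochner_integral_scaleR_left conv)
    then show ?thesis
      by (simp add: has_bochner_integral_integral_eq)
  qed
  ultimately show ?thesis
    by (simp flip: scaleR_scaleR)
qed

section \<open>Hoelder's inequality and the pointwise bound\<close>

text \<open>Young's inequality is applied to \<open>f\<close> and \<open>g\<close> divided by their
  norms and then integrated. If one norm is zero this normalisation fails, but then the product
  vanishes almost everywhere.\<close>

lemma Holder_inequality:
  fixes f g :: "'b \<Rightarrow> real"
  assumes pq: "1 < p" "1 < q" "1 / p + 1 / q = 1"
    and [measurable]: "f \<in> borel_measurable M" "g \<in> borel_measurable M"
    and nonneg: "\<And>x. 0 \<le> f x" "\<And>x. 0 \<le> g x"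
    and f: "integrable M (\<lambda>x. f x powr p)" and g: "integrable M (\<lambda>x. g x powr q)"
  shows "(\<integral>x. f x * g x \<partial>M) \<le> (\<integral>x. f x powr p \<partial>M) powr (1 / p) * (\<integral>x. g x powr q \<partial>M) powr (1 / q)"
proof -
  define A where "A = (\<integral>x. f x powr p \<partial>M)"
  define B where "B = (\<integral>x. g x powr q \<partial>M)"
  have "A \<ge> 0" "B \<ge> 0"
    unfolding A_def B_def by (auto intro!: integral_nonneg_AE)
  show ?thesis
  proof (cases "A = 0 \<or> B = 0")
    case True
    then have "AE x in M. f x * g x = 0"
    proof
      assume "A = 0"
      then have "AE x in M. f x powr p = 0"
        using f by (simp add: A_def integral_nonneg_eq_0_iff_AE)
      then show ?thesis by eventually_elim simp
    next
      assume "B = 0"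
      then have "AE x in M. g x powr q = 0"
        using g by (simp add: B_def integral_nonneg_eq_0_iff_AE)
      then show ?thesis by eventually_elim simp
    qed
    then have "(\<integral>x. f x * g x \<partial>M) = 0"
      by (rule integral_eq_zero_AE)
    then show ?thesis
      by simp
  next
    case False
    with \<open>A \<ge> 0\<close> \<open>B \<ge> 0\<close> have "A > 0" "B > 0" by auto
    define c where "c = A powr (1 / p) * B powr (1 / q)"
    have "c > 0"
      using \<open>A > 0\<close> \<open>B > 0\<close> by (simp add: c_def)
    have young: "f x * g x \<le> c * (f x powr p / (A * p) + g x powr q / (B * q))" for x
    proof -
      have "(f x / A powr (1 / p)) * (g x / B powr (1 / q)) \<le>
          (f x / A powr (1 / p)) powr p / p + (g x / B powr (1 / q)) powr q / q"
        using pq nonneg by (intro Youngs_inequality) auto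
      also have "\<dots> = f x powr p / (A * p) + g x powr q / (B * q)"
        using pq nonneg \<open>A > 0\<close> \<open>B > 0\<close> by (simp add: powr_divide powr_powr)
      finally have "f x * g x / c \<le> f x powr p / (A * p) + g x powr q / (B * q)"
        by (simp add: c_def)
      then show ?thesis
        using \<open>c > 0\<close> by (simp add: pos_divide_le_eq mult.commute)
    qed
    have "(\<integral>x. f x * g x \<partial>M) \<le> (\<integral>x. c * (f x powr p / (A * p) + g x powr q / (B * q)) \<partial>M)"
      using f g young pq \<open>c > 0\<close> \<open>A > 0\<close> \<open>B > 0\<close>
      by (intro integral_mono' integrable_mult_right Bochner_Integration.integrable_add) auto
    also have "\<dots> = c * (A / (A * p) + B / (B * q))"
      using f g by (simp add: A_def B_def)
    also have "\<dots> = c * (1 / p + 1 / q)"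
      using \<open>A > 0\<close> \<open>B > 0\<close> by simp
    also have "\<dots> = c"
      using pq by simp
    finally show ?thesis
      by (simp add: c_def A_def B_def)
  qed
qed

text \<open>By conjugacy, \<open>1 / p < \<gamma>\<close> says exactly that
  \<open>(\<gamma> - 1) * q > -1\<close>, so the \<open>q\<close>-th power of the kernel is
  integrable near its singularity at \<open>s = t\<close>.\<close>

lemma norm_rl_kernel_convolution_le:
  fixes F :: "real \<Rightarrow> 'a::{banach, second_countable_topology}"
  assumes pq: "1 < p" "1 < q" "1 / p + 1 / q = 1" and "1 / p < \<gamma>" and "a \<le> t"
    and [measurable]: "F \<in> borel_measurable borel"
    and F0: "\<And>s. s < a \<Longrightarrow> F s = 0"
    and F: "integrable lborel (\<lambda>s. norm (F s) powr p)"
  shows "norm (\<integral>s. rl_kernel \<gamma> (t - s) *\<^sub>R F s \<partial>lborel) \<le>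
    (t - a) powr (\<gamma> - 1 / p) / (\<gamma> * q - q + 1) powr (1 / q) *
      (\<integral>s. norm (F s) powr p \<partial>lborel) powr (1 / p)"
proof -
  \<comment> \<open>Since \<open>F\<close> vanishes below \<open>a\<close>, the kernel may be cut
    off there; this confines its \<open>q\<close>-th power to a bounded interval.\<close>
  define W where "W = (\<lambda>s. rl_kernel \<gamma> (t - s) * indicator {a..} s)"
  define e where "e = (\<gamma> - 1) * q"
  have "(1 / p - 1) * q < e"
    using pq \<open>1 / p < \<gamma>\<close> unfolding e_def by (intro mult_strict_right_mono) auto
  moreover have "(1 / p - 1) * q = - 1"
  proof -
    have "1 / p - 1 = - (1 / q)"
      using pq by linarith
    with pq show ?thesis
      by (simp only:) simp
  qed
  ultimately have "e > -1"
    by simp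
  have W: "W (t - x) powr q = x powr e * indicator {0..t - a} x" for x
    using pq by (auto simp: W_def e_def rl_kernel_def powr_powr indicator_def)
  have [measurable]: "W \<in> borel_measurable borel"
    unfolding W_def by measurable
  have "(\<integral>\<^sup>+s. ennreal (W s powr q) \<partial>lborel) =
      (\<integral>\<^sup>+x. ennreal (x powr e) * indicator {0..t - a} x \<partial>lborel)"
    by (subst nn_integral_real_affine[where c = "-1" and t = t])
      (auto simp: W ennreal_mult' intro!: nn_integral_cong split: split_indicator)
  also have "\<dots> = ennreal ((t - a) powr (e + 1) / (e + 1))"
    using \<open>e > -1\<close> \<open>a \<le> t\<close>
    by (intro nn_integral_has_integral_lebesgue' has_integral_powr_from_0) auto
  finally have "has_bochner_integral lborel (\<lambda>s. W s powr q) ((t - a) powr (e + 1) / (e + 1))"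
    using \<open>e > -1\<close> by (intro has_bochner_integral_nn_integral) auto
  then have Wq: "integrable lborel (\<lambda>s. W s powr q)"
    "(\<integral>s. W s powr q \<partial>lborel) = (t - a) powr (e + 1) / (e + 1)"
    by (auto simp: has_bochner_integral_iff)
  have "norm (\<integral>s. rl_kernel \<gamma> (t - s) *\<^sub>R F s \<partial>lborel) \<le> (\<integral>s. norm (rl_kernel \<gamma> (t - s) *\<^sub>R F s) \<partial>lborel)"
    by (rule integral_norm_bound)
  also have "\<dots> = (\<integral>s. norm (F s) * W s \<partial>lborel)"
    using F0 by (intro Bochner_Integration.integral_cong) (auto simp: W_def indicator_def)
  also have "\<dots> \<le> (\<integral>s. norm (F s) powr p \<partial>lborel) powr (1 / p) * (\<integral>s. W s powr q \<partial>lborel) powr (1 / q)"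
    using pq F Wq by (intro Holder_inequality) (auto simp: W_def)
  also have "(\<integral>s. W s powr q \<partial>lborel) powr (1 / q) =
      (t - a) powr (\<gamma> - 1 / p) / (\<gamma> * q - q + 1) powr (1 / q)"
  proof -
    \<comment> \<open>The \<open>q\<close>-th root of \<open>(t - a) powr (e + 1)\<close> yields the
      exponent of the claim through \<open>1 / q = 1 - 1 / p\<close>.\<close>
    have "(e + 1) * (1 / q) = \<gamma> - 1 + 1 / q"
      using pq by (simp add: e_def field_simps)
    also have "\<dots> = \<gamma> - 1 / p"
      using pq by simp
    finally have "(e + 1) * (1 / q) = \<gamma> - 1 / p" .
    moreover have "e + 1 = \<gamma> * q - q + 1"
      by (simp add: e_def algebra_simps)
    ultimately show ?thesis
      using \<open>e > -1\<close> unfolding Wq by (metis powr_divide powr_powr)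
  qed
  finally show ?thesis
    by (simp add: mult.commute)
qed


section \<open>Kernel form of the fractional integral, and the norm estimate\<close>

lemma rl_integral_eq_rl_kernel:
  fixes f g :: "real \<Rightarrow> 'a::{banach, second_countable_topology}"
  assumes "\<gamma> \<noteq> 0" "a < t" "t < b"
    and [measurable]: "g \<in> borel_measurable borel"
    and fg: "\<And>s. s \<in> {a<..<b} \<Longrightarrow> f s = g s" and g0: "\<And>s. s \<le> a \<Longrightarrow> g s = 0"
  shows "rl_integral a \<gamma> f t = (1 / Gamma \<gamma>) *\<^sub>R (\<integral>s. rl_kernel \<gamma> (t - s) *\<^sub>R g s \<partial>lborel)"
proof -
  \<comment> \<open>\<open>H\<close> copies the value of \<open>f\<close> at \<open>a\<close>, so
    that it equals the original integrand at every point and, being Borel, lets the Lebesgue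
    integral be taken over \<open>lborel\<close>. Only then is \<open>a\<close> discarded as a null
    set. At \<open>s = t\<close> both integrands vanish because \<open>0 powr e\<close> is
    0.\<close>
  define H where "H = (\<lambda>s. if s = a then (t - a) powr (\<gamma> - 1) *\<^sub>R f a else rl_kernel \<gamma> (t - s) *\<^sub>R g s)"
  have [measurable]: "H \<in> borel_measurable borel"
    unfolding H_def by measurable
  have "indicator {a..t} s *\<^sub>R ((t - s) powr (\<gamma> - 1) *\<^sub>R f s) = H s" for s
    using assms by (cases s a rule: linorder_cases) (auto simp: H_def rl_kernel_def split: split_indicator)
  then have "(LINT s:{a..t}|lebesgue. ((t - s) powr (\<gamma> - 1)) *\<^sub>R f s) = (\<integral>s. H s \<partial>lborel)"
    unfolding set_lebesgue_integral_def by (simp add: integral_completion)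
  also have "\<dots> = (\<integral>s. rl_kernel \<gamma> (t - s) *\<^sub>R g s \<partial>lborel)"
  proof (rule integral_cong_AE)
    show "AE s in lborel. H s = rl_kernel \<gamma> (t - s) *\<^sub>R g s"
      using AE_lborel_singleton[of a] by eventually_elim (simp add: H_def)
  qed measurable
  finally show ?thesis
    using \<open>\<gamma> \<noteq> 0\<close> by (simp add: rl_integral_def)
qed

theorem theorem3p4:
  fixes a b p q \<alpha> \<beta> :: real
    and u :: "real \<Rightarrow> 'a::{real_normed_field,euclidean_space}"
  assumes "a < b"
    and "1 < p" and "p \<le> q" and "1 / p + 1 / q = 1"
    and "0 \<le> \<beta>" and "\<beta> < 1"
    and "\<beta> + 1 / p < \<alpha>" and "\<alpha> \<le> 1"
    and "absolutely_continuous_fun a b u"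
    and "caputo_deriv a b \<alpha> u \<in> Lp_space p (lebesgue_on {a<..<b})"
  shows "Linf_norm (lebesgue_on {a<..<b}) (caputo_deriv a b \<beta> u)
    \<le> ereal ((b - a) powr (\<alpha> - \<beta> - 1 / p)
        / ((\<alpha> * q - \<beta> * q - q + 1) powr (1 / q) * Gamma (\<alpha> - \<beta>))
        * Lp_norm p (lebesgue_on {a<..<b}) (caputo_deriv a b \<alpha> u))"
proof -
  define M where "M = lebesgue_on {a<..<b}"
  define du where "du = (\<lambda>s. vector_derivative u (at s within {a..b}))"
  define g where "g = (\<lambda>s. indicator {a<..<b} s *\<^sub>R du s)"
  define \<gamma> where "\<gamma> = \<alpha> - \<beta>"
  \<comment> \<open>A Borel representative of the derivative of order \<open>\<alpha>\<close>,
    extended by 0. For \<open>\<alpha> = 1\<close> the integral has order 0, which is the identity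
    and has no kernel.\<close>
  define F where "F = (if \<alpha> = 1 then g else (\<lambda>s. indicator {a<..<b} s *\<^sub>R
      ((1 / Gamma (1 - \<alpha>)) *\<^sub>R (\<integral>r. rl_kernel (1 - \<alpha>) (s - r) *\<^sub>R g r \<partial>lborel))))"
  have "1 / p > 0"
    using \<open>1 < p\<close> by simp
  then have "1 / p < \<gamma>" "\<gamma> > 0"
    using \<open>\<beta> + 1 / p < \<alpha>\<close> unfolding \<gamma>_def by linarith+
  have "1 < q"
    using \<open>1 < p\<close> \<open>p \<le> q\<close> by simp
  have "continuous_on {a..b} u"
    using assms by (intro absolutely_continuous_fun_imp_continuous_on)
  then have g_meas [measurable]: "g \<in> borel_measurable borel"
    unfolding g_def du_def using \<open>a < b\<close> by (intro borel_measurable_vector_derivative_within)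
  have F_meas [measurable]: "F \<in> borel_measurable borel"
    by (cases "\<alpha> = 1") (simp_all add: F_def)
  have caputo: "caputo_deriv a b \<theta> u t =
      (1 / Gamma (1 - \<theta>)) *\<^sub>R (\<integral>s. rl_kernel (1 - \<theta>) (t - s) *\<^sub>R g s \<partial>lborel)"
    if "t \<in> {a<..<b}" "\<theta> \<noteq> 1" for t \<theta>
    unfolding caputo_deriv_def du_def [symmetric]
    by (rule rl_integral_eq_rl_kernel[where b = b]) (use that g_meas in \<open>auto simp: g_def\<close>)
  have F: "indicator {a<..<b} s *\<^sub>R caputo_deriv a b \<alpha> u s = F s" for s
  proof (cases "\<alpha> = 1")
    case True
    then show ?thesis
      by (simp add: F_def g_def du_def caputo_deriv_def rl_integral_def)
  next
    case False
    then show ?thesis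
      by (simp add: F_def caputo split: split_indicator)
  qed
  then have F0: "F s = 0" if "s < a" for s
    using that by (metis greaterThanLessThan_iff indicator_simps(2) not_less_iff_gr_or_eq scaleR_zero_left)
  \<comment> \<open>This moves integrability and the norm from Lebesgue measure on the interval to
    \<open>lborel\<close>, where \<open>F\<close> lives.\<close>
  have F_powr: "indicator {a<..<b} s * norm (caputo_deriv a b \<alpha> u s) powr p = norm (F s) powr p" for s
    unfolding F [symmetric] by (simp split: split_indicator)
  have "integrable M (\<lambda>s. norm (caputo_deriv a b \<alpha> u s) powr p)"
    using assms by (simp add: Lp_space_def M_def)
  then have F_int: "integrable lborel (\<lambda>s. norm (F s) powr p)"
    unfolding M_def by (subst (asm) integrable_restrict_space) (auto simp: F_powr integrable_completion)
  have F_norm: "Lp_norm p M (caputo_deriv a b \<alpha> u) = (\<integral>s. norm (F s) powr p \<partial>lborel) powr (1 / p)"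
    unfolding Lp_norm_def M_def by (subst integral_restrict_space) (auto simp: F_powr integral_completion)
  define N where "N = Lp_norm p M (caputo_deriv a b \<alpha> u)"
  have "N \<ge> 0"
    by (simp add: N_def Lp_norm_def)
  define C where "C = (b - a) powr (\<gamma> - 1 / p) / (\<gamma> * q - q + 1) powr (1 / q)"
  have "C \<ge> 0"
    by (simp add: C_def)
  have bound: "norm (caputo_deriv a b \<beta> u t) \<le> C / Gamma \<gamma> * N" if t: "t \<in> {a<..<b}" for t
  proof -
    let ?I = "\<integral>s. rl_kernel \<gamma> (t - s) *\<^sub>R F s \<partial>lborel"
    \<comment> \<open>In the first alternative the bound is trivial, its right-hand side being
      nonnegative.\<close>
    have "caputo_deriv a b \<beta> u t = 0 \<or> caputo_deriv a b \<beta> u t = (1 / Gamma \<gamma>) *\<^sub>R ?I"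
    proof (cases "integrable lborel (\<lambda>s. rl_kernel (1 - \<beta>) (t - s) *\<^sub>R g s)")
      case False
      then show ?thesis
        using t \<open>\<beta> < 1\<close> by (simp add: caputo not_integrable_integral_eq)
    next
      case int: True
      show ?thesis
      proof (cases "\<alpha> = 1")
        case True
        then show ?thesis
          using t \<open>\<beta> < 1\<close> by (simp add: caputo F_def \<gamma>_def)
      next
        case False
        then have "1 - \<alpha> > 0"
          using \<open>\<alpha> \<le> 1\<close> by simp
        let ?G = "\<lambda>s. \<integral>r. rl_kernel (1 - \<alpha>) (s - r) *\<^sub>R g r \<partial>lborel"
        have sum_eq: "\<gamma> + (1 - \<alpha>) = 1 - \<beta>"
          by (simp add: \<gamma>_def)
        have semi: "(\<integral>s. rl_kernel \<gamma> (t - s) *\<^sub>R ?G s \<partial>lborel) =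
            Beta \<gamma> (1 - \<alpha>) *\<^sub>R (\<integral>s. rl_kernel (1 - \<beta>) (t - s) *\<^sub>R g s \<partial>lborel)"
          using rl_kernel_semigroup[OF \<open>\<gamma> > 0\<close> \<open>1 - \<alpha> > 0\<close> g_meas, of t] int
          by (simp only: sum_eq)
        have G0: "?G s = 0" if "s \<le> a" for s
        proof -
          have "rl_kernel (1 - \<alpha>) (s - r) *\<^sub>R g r = 0" for r
            using that by (auto simp: rl_kernel_def g_def)
          then show ?thesis
            by (simp only: integral_zero)
        qed
        \<comment> \<open>The cutoff inside \<open>F\<close> loses nothing: \<open>?G\<close>
          vanishes up to \<open>a\<close>, and the kernel vanishes from \<open>t < b\<close>
          onwards.\<close>
        have "rl_kernel \<gamma> (t - s) *\<^sub>R F s = (1 / Gamma (1 - \<alpha>)) *\<^sub>R (rl_kernel \<gamma> (t - s) *\<^sub>R ?G s)" for s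
          using t False G0[of s] by (auto simp: F_def rl_kernel_def split: split_indicator)
        then have "?I = (1 / Gamma (1 - \<alpha>)) *\<^sub>R (Beta \<gamma> (1 - \<alpha>) *\<^sub>R
            (\<integral>s. rl_kernel (1 - \<beta>) (t - s) *\<^sub>R g s \<partial>lborel))"
          by (simp only: integral_scaleR_right semi)
        moreover have "Gamma \<gamma> > 0" "Gamma (1 - \<alpha>) > 0"
          using \<open>\<gamma> > 0\<close> \<open>1 - \<alpha> > 0\<close> by auto
        \<comment> \<open>The Beta factor from the semigroup law is
          \<open>Gamma \<gamma> * Gamma (1 - \<alpha>) / Gamma (1 - \<beta>)\<close>, which trades
          the two normalisations for one.\<close>
        then have "1 / Gamma (1 - \<beta>) = 1 / Gamma \<gamma> * (1 / Gamma (1 - \<alpha>) * Beta \<gamma> (1 - \<alpha>))"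
          unfolding Beta_def sum_eq by simp
        ultimately have "caputo_deriv a b \<beta> u t = (1 / Gamma \<gamma>) *\<^sub>R ?I"
          using t \<open>\<beta> < 1\<close> by (simp add: caputo)
        then show ?thesis ..
      qed
    qed
    moreover have "norm ?I \<le> (t - a) powr (\<gamma> - 1 / p) / (\<gamma> * q - q + 1) powr (1 / q) * N"
      unfolding N_def F_norm
      by (rule norm_rl_kernel_convolution_le)
        (use t assms \<open>1 < q\<close> \<open>1 / p < \<gamma>\<close> F_int F_meas F0 in auto)
    \<comment> \<open>The exponent \<open>\<gamma> - 1 / p\<close> is positive, so enlarging
      \<open>t - a\<close> to \<open>b - a\<close> makes the bound uniform in
      \<open>t\<close>.\<close>
    moreover have "\<dots> \<le> C * N"
      unfolding C_def using t \<open>1 / p < \<gamma>\<close> \<open>N \<ge> 0\<close>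
      by (intro mult_right_mono divide_right_mono powr_mono2) auto
    ultimately show ?thesis
      using \<open>C \<ge> 0\<close> \<open>N \<ge> 0\<close> Gamma_real_pos[OF \<open>\<gamma> > 0\<close>] by (auto simp: divide_right_mono)
  qed
  \<comment> \<open>\<open>Linf_norm\<close> is infinite on non-measurable functions, so
    measurability must be proved; on the interval the derivative is a parameter integral of a
    jointly Borel function.\<close>
  have "caputo_deriv a b \<beta> u \<in> borel_measurable M \<longleftrightarrow>
      (\<lambda>t. (1 / Gamma (1 - \<beta>)) *\<^sub>R (\<integral>s. rl_kernel (1 - \<beta>) (t - s) *\<^sub>R g s \<partial>lborel)) \<in> borel_measurable M"
    using \<open>\<beta> < 1\<close> by (intro measurable_cong) (auto simp: M_def caputo)
  also have "\<dots>"
    unfolding M_def by (intro measurable_restrict_space1 measurable_completion) measurable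
  finally have meas: "caputo_deriv a b \<beta> u \<in> borel_measurable M" .
  moreover have "esssup M (\<lambda>t. ereal (norm (caputo_deriv a b \<beta> u t))) \<le> ereal (C / Gamma \<gamma> * N)"
  proof (rule esssup_I)
    show "(\<lambda>t. ereal (norm (caputo_deriv a b \<beta> u t))) \<in> borel_measurable M"
      using meas by measurable
    show "AE t in M. ereal (norm (caputo_deriv a b \<beta> u t)) \<le> ereal (C / Gamma \<gamma> * N)"
      using bound by (intro AE_I2) (simp add: M_def)
  qed
  moreover have "\<gamma> * q - q + 1 = \<alpha> * q - \<beta> * q - q + 1"
    by (simp add: \<gamma>_def algebra_simps)
  ultimately show ?thesis
    by (simp add: Linf_norm_def C_def N_def M_def \<gamma>_def)
qed

end
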